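(* Let $v_{\mathrm{nc}}\in V_{\mathrm{nc}}$ and real numbers $\widehat\beta_0,L,\widehat\mu>0$ satisfy $2L\widehat\mu<\widehat\beta_0^2$ and (N1) $\|DG(v)-DG(w)\|_{L(V;V^* )}\le L\,|||v-w|||$ for all $v,w\in V$, (N2) $|||N(Jv_{\mathrm{nc}})|||_*\le\widehat\mu$, (N3) $DN(Jv_{\mathrm{nc}})\in L(V;V^* )$ is invertible and fulfils the inf--sup condition $$\widehat\beta_0\le\inf_{0\ne v\in V}\sup_{0\ne\varphi\in V}\frac{DN(Jv_{\mathrm{nc}};v,\varphi)}{|||v|||\,|||\varphi|||}.$$ Then: (a) there exists a root $u\in V$ of $N$ in the neighbourhood of $v_{\mathrm{nc}}$ with the error bound $$|||u-v_{\mathrm{nc}}|||_{\mathrm{pw}}\le\frac{\widehat\beta_0-\sqrt{\widehat\beta_0^2-2L\widehat\mu}}{L}+|||(1-J)v_{\mathrm{nc}}|||_{\mathrm{pw}}\eqqcolon\varrho_{\mathrm{ex}};$$ (b) there exists no other root $v\neq u$, $v\in V$, of $N$ such that $$|||v-v_{\mathrm{nc}}|||_{\mathrm{pw}}\le\frac{\widehat\beta_0+\sqrt{\widehat\beta_0^2-2L\widehat\mu}}{L}-|||(1-J)v_{\mathrm{nc}}|||_{\mathrm{pw}}\eqqcolon\varrho_{\mathrm{uq}};$$ (c) the root $u$ in (a) is a regular root with an inf--sup constant bounded from below by $$\beta_0\coloneqq\sqrt{\widehat\beta_0^2-2L\widehat\mu}\le\inf_{0\ne v\in V}\sup_{0\ne\varphi\in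 V}\frac{DN(u;v,\varphi)}{|||v|||\,|||\varphi|||}.$$
   Context: $(V,a)$ is a (real) Hilbert space with scalar product $a(\cdot,\cdot)$, induced norm $|||\cdot|||$, and dual $V^*$ with operator norm $|||\cdot|||_*$. $G\in C^1(V;V^* )$ is a compact nonlinear operator, $F\in V^*$, and $N\in C^1(V;V^* )$ is given by $N(v)\coloneqq a(v,\cdot)+G(v)-F$. Write $DN(u;v,\varphi)=a(v,\varphi)+DG(u;v,\varphi)$ for $(DN(u)v)(\varphi)$, where $DN$ and $DG$ are Fréchet derivatives. A root $u\in V$, $N(u)=0$, is regular if $DN(u)\in L(V;V^* )$ is bijective. Nonconforming setting: $V_{\mathrm{nc}}$ is a vector space (in general $V_{\mathrm{nc}}\not\subset V$), $V_{\mathrm{pw}}\coloneqq V+V_{\mathrm{nc}}$, and $a_{\mathrm{pw}}$ is a symmetric positive semi-definite bilinear form on $V_{\mathrm{pw}}$ that extends $a$ (i.e. $a=a_{\mathrm{pw}}|_{V\times V}$) with induced seminorm $|||\cdot|||_{\mathrm{pw}}$, and is a scalar product on $V_{\mathrm{nc}}$. The interpolation $I\in L(V;V_{\mathrm{nc}})$ satisfies $a_{\mathrm{pw}}(v-Iv,w_{\mathrm{nc}})=0$ for all $v\in V$, $w_{\mathrm{nc}}\in V_{\mathrm{nc}}$. The smoother $J:V_{\mathrm{nc}}\to V$ is a bounded linear right-inverse of $I$, i.e. $IJw_{\mathrm{nc}}=w_{\mathrm{nc}}$ for all $w_{\mathrm{nc}}\in V_{\mathrm{nc}}$, and is quasi-optimal: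 there is $\Lambda_J>0$ with $|||w_{\mathrm{nc}}-Jw_{\mathrm{nc}}|||_{\mathrm{pw}}\le\Lambda_J\min_{v\in V}|||v-w_{\mathrm{nc}}|||_{\mathrm{pw}}$ for all $w_{\mathrm{nc}}\in V_{\mathrm{nc}}$.
   Formalization: In (b), if |||(1-J)v_nc|||_pw = 0, uniqueness is stated only for |||v-v_nc|||_pw < ρ_uq, since with ≤ it fails: V=V_nc=ℝ, I=J=id, v_nc=0, N(t)=3/8-t+t²/2, β̂_0=L=1, μ̂=3/8 has roots 1/2=ρ_ex and 3/2=ρ_uq. Otherwise ≤ is kept. *)

theory Defs
  imports "HOL-Analysis.Analysis"
begin

definition frechet :: "('a::real_normed_vector \<Rightarrow> 'b::real_normed_vector) \<Rightarrow> 'a \<Rightarrow> 'a \<Rightarrow>\<^sub>L 'b"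
  where "frechet f u = Blinfun (frechet_derivative f (at u))"

definition C1 :: "('a::real_normed_vector \<Rightarrow> 'b::real_normed_vector) \<Rightarrow> bool"
  where "C1 f \<longleftrightarrow> (\<forall>u. f differentiable (at u)) \<and> continuous_on UNIV (frechet f)"

definition compact_operator :: "('a::real_normed_vector \<Rightarrow> 'b::real_normed_vector) \<Rightarrow> bool"
  where "compact_operator f \<longleftrightarrow>
    continuous_on UNIV f \<and> (\<forall>B. bounded B \<longrightarrow> compact (closure (f ` B)))"

text \<open>
  The Hilbert space V with scalar product a is a type of class real_inner and complete_space;
  a is its inner product and the dual of V is the type of bounded linear functionals, with
  its operator norm. The operator is N(v) = a(v, .) + G(v) - F.
\<close>

definition nonlin_op ::
  "('v::{real_inner,complete_space} \<Rightarrow> 'v \<Rightarrow>\<^sub>L real) \<Rightarrow> ('v \<Rightarrow>\<^sub>L real) \<Rightarrow> 'v \<Rightarrow> 'v \<Rightarrow>\<^sub>L real"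
  where "nonlin_op G F v = blinfun_inner_right v + G v - F"

definition regular_root ::
  "('v::{real_inner,complete_space} \<Rightarrow> 'v \<Rightarrow>\<^sub>L real) \<Rightarrow> 'v \<Rightarrow> bool"
  where "regular_root N u \<longleftrightarrow> N u = 0 \<and> bij (blinfun_apply (frechet N u))"

text \<open>
  The value is an extended real, so that the infimum over the empty set, for V = 0, is infinite.
  For V \<noteq> 0 the value is finite.
\<close>

definition inf_sup :: "('v::{real_inner,complete_space} \<Rightarrow>\<^sub>L ('v \<Rightarrow>\<^sub>L real)) \<Rightarrow> ereal"
  where "inf_sup A =
    (INF v\<in>-{0}. SUP \<phi>\<in>-{0}. ereal (blinfun_apply (blinfun_apply A v) \<phi> / (norm v * norm \<phi>)))"

definition pw_norm :: "('p \<Rightarrow> 'p \<Rightarrow> real) \<Rightarrow> 'p \<Rightarrow> real"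
  where "pw_norm a_pw x = sqrt (a_pw x x)"

text \<open>
  The type 'p is the space V_pw = V + V_nc, and iV, iN are the inclusions of V and of V_nc into
  it; the sum need not be direct. The inner product of 'n is the scalar product that a_pw induces
  on V_nc, so norms and boundedness on V_nc refer to a_pw. The inclusions are
  injective because a_pw restricts along each of them to a definite form. The infimum in
  quasi_optimal is a minimum since V is complete with respect to a.
\<close>

locale nonconforming_setting =
  fixes a_pw :: "'p::real_vector \<Rightarrow> 'p \<Rightarrow> real"
    and iV :: "'v::{real_inner,complete_space} \<Rightarrow> 'p"
    and iN :: "'n::real_inner \<Rightarrow> 'p"
    and I :: "'v \<Rightarrow>\<^sub>L 'n"
    and J :: "'n \<Rightarrow>\<^sub>L 'v"
  assumes linear_iV: "linear iV"
    and linear_iN: "linear iN"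
    and pw_sum: "\<forall>x. \<exists>v w. x = iV v + iN w"
    and pw_bilinear: "bilinear a_pw"
    and pw_sym: "\<forall>x y. a_pw x y = a_pw y x"
    and pw_nonneg: "\<forall>x. 0 \<le> a_pw x x"
    and pw_extends: "\<forall>v w. a_pw (iV v) (iV w) = v \<bullet> w"
    and pw_scalar_nc: "\<forall>v w. a_pw (iN v) (iN w) = v \<bullet> w"
    and I_orth: "\<forall>v w. a_pw (iV v - iN (blinfun_apply I v)) (iN w) = 0"
    and J_right_inverse: "\<forall>w. blinfun_apply I (blinfun_apply J w) = w"
    and quasi_optimal: "\<exists>\<Lambda>>0. \<forall>w. pw_norm a_pw (iN w - iV (blinfun_apply J w))
          \<le> \<Lambda> * (INF v. pw_norm a_pw (iV v - iN w))"

text \<open>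
  On uniqueness: if the distance of v_nc to J v_nc vanishes, the uniqueness ball has to be open.
  On V = V_nc = \<real> with I = J = id, the functional N(t) = (3/8 - t + t^2/2) a(1, .) satisfies the
  hypotheses at v_nc = 0 with parameters \<beta> = 1, L = 1, \<mu> = 3/8. Its roots are 1/2 and 3/2,
  and the radii (\<beta> - sqrt (\<beta>^2 - 2 L \<mu>)) / L and (\<beta> + sqrt (\<beta>^2 - 2 L \<mu>)) / L are 1/2 and 3/2
  as well. If the distance is positive, the ball may be closed: a root v on its boundary would force v_nc
  to have distance 0 to V, which quasi_optimal excludes.
\<close>

end

theory Submission
  imports Defs
begin

text \<open>
  Write x0 = J v_nc, A = DN(x0) and s = sqrt (\<beta>^2 - 2 * L * \<mu>) > 0. The simplified Newton map that
  subtracts the A-preimage of N(x) from x is a contraction of the closed ball of radius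
  r = (\<beta> - s) / L around x0; r is the smaller root of \<mu> + L * r^2 / 2 = \<beta> * r.
  The linearization error N(x) - N(y) - A(x - y) is at most L / 2 * (|x - x0| + |y - x0|) * |x - y|,
  so two roots coincide as soon as their distances to x0 sum to less than 2 * \<beta> / L; this
  gives the uniqueness radius (\<beta> + s) / L. Distances to v_nc follow by the triangle inequality,
  which is strict if v_nc has positive distance to J v_nc: equality would place v_nc at distance 0
  from a convex combination of v and J v_nc, against quasi-optimality.
\<close>

section \<open>Derivatives of \<open>nonlin_op\<close> and inf-sup constants as norm bounds\<close>

lemma frechet_has_derivative:
  assumes "f differentiable (at x)"
  shows "(f has_derivative blinfun_apply (frechet f x)) (at x)"
proof -
  have "(f has_derivative frechet_derivative f (at x)) (at x)"
    using assms by (simp add: frechet_derivative_works)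
  then show ?thesis
    by (simp add: frechet_def bounded_linear_Blinfun_apply has_derivative_bounded_linear)
qed

lemma frechet_eqI:
  assumes "(f has_derivative blinfun_apply A) (at x)"
  shows "frechet f x = A"
  unfolding frechet_def frechet_derivative_at[OF assms, symmetric] by (rule blinfun_apply_inverse)

text \<open>The map \<open>blinfun_inner_right\<close> is bounded linear, hence its own derivative
  at every point, and the constant \<open>F\<close> drops out.\<close>

lemma nonlin_op_has_derivative:
  assumes "C1 G"
  shows "(nonlin_op G F has_derivative blinfun_apply (frechet (nonlin_op G F) u)) (at u)"
    and "frechet (nonlin_op G F) u = Blinfun blinfun_inner_right + frechet G u"
proof -
  have G: "(G has_derivative blinfun_apply (frechet G u)) (at u)"
    using assms by (simp add: C1_def frechet_has_derivative)
  have "(nonlin_op G F has_derivative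
      (\<lambda>h. blinfun_inner_right h + frechet G u h)) (at u)"
    unfolding nonlin_op_def by (auto intro!: derivative_eq_intros G)
  then have D: "(nonlin_op G F has_derivative
      blinfun_apply (Blinfun blinfun_inner_right + frechet G u)) (at u)"
    by (simp add: plus_blinfun.rep_eq bounded_linear_Blinfun_apply bounded_linear_blinfun_inner_right)
  show "frechet (nonlin_op G F) u = Blinfun blinfun_inner_right + frechet G u"
    by (rule frechet_eqI[OF D])
  with D show "(nonlin_op G F has_derivative blinfun_apply (frechet (nonlin_op G F) u)) (at u)"
    by simp
qed

text \<open>The inner supremum is the dual norm of \<open>A v\<close> divided by
  \<open>norm v\<close>. This translates between the extended-real inf-sup constant and the norm
  estimate on which the Newton argument runs. For V = 0 both sides hold trivially.\<close>

lemma inf_sup_ge_iff: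
  fixes A :: "'v::{real_inner,complete_space} \<Rightarrow>\<^sub>L ('v \<Rightarrow>\<^sub>L real)"
  shows "ereal s \<le> inf_sup A \<longleftrightarrow> (\<forall>v. s * norm v \<le> norm (A v))"
proof
  assume s: "ereal s \<le> inf_sup A"
  show "\<forall>v. s * norm v \<le> norm (A v)"
  proof
    fix v
    show "s * norm v \<le> norm (A v)"
    proof (cases "v = 0")
      case False
      have "ereal s \<le> (SUP \<phi>\<in>-{0}. ereal (A v \<phi> / (norm v * norm \<phi>)))"
        using s False unfolding inf_sup_def by (auto simp: le_INF_iff)
      also have "\<dots> \<le> ereal (norm (A v) / norm v)"
      proof (rule SUP_least)
        fix \<phi> :: 'v assume "\<phi> \<in> -{0}"
        moreover have "A v \<phi> \<le> norm (A v) * norm \<phi>"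
          using norm_blinfun[of "A v" \<phi>] by simp
        ultimately show "ereal (A v \<phi> / (norm v * norm \<phi>)) \<le> ereal (norm (A v) / norm v)"
          using False by (simp add: field_simps)
      qed
      finally show ?thesis using False by (simp add: field_simps)
    qed simp
  qed
next
  assume lower: "\<forall>v. s * norm v \<le> norm (A v)"
  show "ereal s \<le> inf_sup A"
    unfolding inf_sup_def
  proof (rule INF_greatest, rule ccontr)
    fix v :: 'v assume "v \<in> -{0}"
    then have v: "norm v > 0" by simp
    assume "\<not> ereal s \<le> (SUP \<phi>\<in>-{0}. ereal (A v \<phi> / (norm v * norm \<phi>)))"
    then have "(SUP \<phi>\<in>-{0}. ereal (A v \<phi> / (norm v * norm \<phi>))) < ereal s" by simp
    \<comment> \<open>A real number strictly between the supremum and \<open>s\<close> replaces the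
      extended-real supremum, so that the rest is real arithmetic.\<close>
    from ereal_dense2[OF this]
    obtain t where t: "(SUP \<phi>\<in>-{0}. ereal (A v \<phi> / (norm v * norm \<phi>))) < ereal t" "t < s"
      by auto
    have le: "A v \<phi> \<le> t * norm v * norm \<phi>" for \<phi>
    proof (cases "\<phi> = 0")
      case False
      have "ereal (A v \<phi> / (norm v * norm \<phi>)) \<le> ereal t"
        using False by (intro order_trans[OF SUP_upper less_imp_le[OF t(1)]]) simp
      then show ?thesis using v False by (simp add: field_simps)
    qed simp
    \<comment> \<open>The quotient carries no absolute value; testing with \<open>-\<phi>\<close>
      supplies the other sign.\<close>
    have abs_le: "norm (A v \<phi>) \<le> t * norm v * norm \<phi>" for \<phi>
      using le[of \<phi>] le[of "-\<phi>"] by (auto simp: blinfun.minus_right)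
    \<comment> \<open>The sign of \<open>t\<close> is not known beforehand, but
      \<open>norm_blinfun_bound\<close> asks for a nonnegative bound; testing with \<open>v\<close>
      itself gives it.\<close>
    have "0 \<le> t * norm v * norm v"
      using abs_le[of v] by (rule order_trans[OF norm_ge_zero])
    then have "0 \<le> t * norm v" using v by (simp add: zero_le_mult_iff)
    then have "norm (A v) \<le> t * norm v" using abs_le by (rule norm_blinfun_bound)
    also have "\<dots> < s * norm v" using t v by simp
    finally show False using lower by (meson not_le)
  qed
qed

section \<open>A Newton-Kantorovich theorem in Banach spaces\<close>

lemma linearization_error:
  fixes f :: "'a::real_normed_vector \<Rightarrow> 'b::real_normed_vector"
  assumes deriv: "\<And>x. (f has_derivative blinfun_apply (f' x)) (at x)"
    and lip: "\<And>x y. norm (f' x - f' y) \<le> L * norm (x - y)"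
    and L: "L \<ge> 0"
  shows "norm (f x - f y - f' z (x - y)) \<le> L / 2 * (norm (x - z) + norm (y - z)) * norm (x - y)"
proof -
  \<comment> \<open>Along the segment from \<open>y\<close> to \<open>x\<close>, \<open>g\<close>
    removes the linear part taken at \<open>z\<close>, so \<open>g 1 - g 0\<close> is the error to
    be bounded.\<close>
  define g where "g t = f (y + t *\<^sub>R (x - y)) - t *\<^sub>R f' z (x - y)" for t :: real
  \<comment> \<open>An antiderivative of the bound on the derivative of \<open>g\<close>: by
    convexity of the norm, the distance of the segment point to \<open>z\<close> is at most the
    interpolation of the end distances. Averaging these over the segment gives the factor 1/2 in
    \<open>p 1\<close>.\<close>
  define p where "p t = L * norm (x - y) * (t * norm (y - z) + t\<^sup>2 / 2 * (norm (x - z) - norm (y - z)))" for t :: real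
  have g': "(g has_vector_derivative (f' (y + t *\<^sub>R (x - y)) - f' z) (x - y)) (at t)" for t
  proof -
    have "((\<lambda>t. f (y + t *\<^sub>R (x - y))) has_derivative
        (\<lambda>h. f' (y + t *\<^sub>R (x - y)) (h *\<^sub>R (x - y)))) (at t)"
      by (rule has_derivative_compose[where f = "\<lambda>t. y + t *\<^sub>R (x - y)", OF _ deriv]) (auto intro!: derivative_eq_intros)
    then show ?thesis
      unfolding g_def has_vector_derivative_def
      by (auto intro!: derivative_eq_intros
        simp: blinfun.diff_left blinfun.scaleR_right scaleR_diff_right[of _ "blinfun_apply _ _"]
        simp del: scaleR_diff_right)
  qed
  have p': "(p has_vector_derivative L * norm (x - y) * ((1 - t) * norm (y - z) + t * norm (x - z))) (at t)" for t
    unfolding p_def has_real_derivative_iff_has_vector_derivative[symmetric]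
    by (auto intro!: derivative_eq_intros simp: field_simps)
  have "norm (g 1 - g 0) \<le> p 1 - p 0"
  proof (rule differentiable_bound_general[of 0 1 g p])
    show "continuous_on {0..1} g" "continuous_on {0..1} p"
      using g' p' by (meson continuous_at_imp_continuous_on has_vector_derivative_continuous)+
    fix t :: real assume t: "0 < t" "t < 1"
    have "y + t *\<^sub>R (x - y) - z = (1 - t) *\<^sub>R (y - z) + t *\<^sub>R (x - z)"
      by (simp add: algebra_simps)
    then have "norm (y + t *\<^sub>R (x - y) - z) \<le> (1 - t) * norm (y - z) + t * norm (x - z)"
      using t norm_triangle_ineq[of "(1 - t) *\<^sub>R (y - z)" "t *\<^sub>R (x - z)"] by simp
    then have "norm (f' (y + t *\<^sub>R (x - y)) - f' z) \<le> L * ((1 - t) * norm (y - z) + t * norm (x - z))"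
      using lip L by (meson mult_left_mono order_trans)
    then have "norm (f' (y + t *\<^sub>R (x - y)) - f' z) * norm (x - y)
        \<le> L * ((1 - t) * norm (y - z) + t * norm (x - z)) * norm (x - y)"
      by (rule mult_right_mono) simp
    then show "norm ((f' (y + t *\<^sub>R (x - y)) - f' z) (x - y))
        \<le> L * norm (x - y) * ((1 - t) * norm (y - z) + t * norm (x - z))"
      using norm_blinfun[of "f' (y + t *\<^sub>R (x - y)) - f' z" "x - y"] by (simp add: mult_ac)
  qed (use g' p' in auto)
  then show ?thesis
    by (simp add: g_def p_def field_simps)
qed

text \<open>Solving \<open>B x = y\<close> is a fixed point problem for the map taking
  \<open>x\<close> to the \<open>A\<close>-preimage of \<open>y - (B - A) x\<close>, which contracts
  with factor \<open>norm (B - A) / \<beta>\<close>. Existence of the fixed point gives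
  surjectivity, uniqueness gives injectivity. The lower bound on \<open>A\<close> controls the
  inverse, so completeness of the domain is enough.\<close>

lemma bij_blinfun_perturb:
  fixes A B :: "'a::{real_normed_vector,complete_space} \<Rightarrow>\<^sub>L 'b::real_normed_vector"
  assumes bij: "bij (blinfun_apply A)"
    and lower: "\<And>v. \<beta> * norm v \<le> norm (A v)"
    and close: "norm (B - A) < \<beta>"
  shows "bij (blinfun_apply B)"
proof (rule bijI)
  have \<beta>: "\<beta> > 0" using close norm_ge_zero[of "B - A"] by linarith
  define T where "T y x = inv (blinfun_apply A) (y - (B - A) x)" for y x
  have AT: "A (T y x) = y - (B - A) x" for y x
    unfolding T_def using bij by (simp add: bij_is_surj surj_f_inv_f)
  have fix_iff: "T y x = x \<longleftrightarrow> B x = y" for x y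
  proof -
    have "T y x = x \<longleftrightarrow> A (T y x) = A x"
      using bij by (metis bij_is_inj injD)
    also have "\<dots> \<longleftrightarrow> B x = y" unfolding AT by (auto simp: blinfun.diff_left)
    finally show ?thesis .
  qed
  have ex1: "\<exists>!x. T y x = x" for y
  proof (rule banach_fix_type[of "norm (B - A) / \<beta>"])
    show "\<forall>x x'. dist (T y x) (T y x') \<le> norm (B - A) / \<beta> * dist x x'"
    proof (intro allI)
      fix x x'
      have "\<beta> * norm (T y x - T y x') \<le> norm (A (T y x - T y x'))" by (rule lower)
      also have "A (T y x - T y x') = (B - A) (x' - x)"
        by (simp only: blinfun.diff_right AT) simp
      also have "norm \<dots> \<le> norm (B - A) * norm (x' - x)" by (rule norm_blinfun)
      finally show "dist (T y x) (T y x') \<le> norm (B - A) / \<beta> * dist x x'"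
        using \<beta> by (simp add: dist_norm field_simps norm_minus_commute)
    qed
  qed (use \<beta> close in auto)
  show "inj (blinfun_apply B)" using ex1 unfolding fix_iff by (metis injI)
  show "surj (blinfun_apply B)" using ex1 unfolding fix_iff by (metis surjI)
qed

lemma newton_kantorovich:
  fixes f :: "'a::{real_normed_vector,complete_space} \<Rightarrow> 'b::real_normed_vector"
  assumes deriv: "\<And>x. (f has_derivative blinfun_apply (f' x)) (at x)"
    and lip: "\<And>x y. norm (f' x - f' y) \<le> L * norm (x - y)"
    and pos: "\<beta> > 0" "L > 0" "\<mu> \<ge> 0"
    and small: "2 * L * \<mu> < \<beta>\<^sup>2"
    and bij: "bij (blinfun_apply (f' x\<^sub>0))"
    and lower: "\<And>v. \<beta> * norm v \<le> norm (f' x\<^sub>0 v)"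
    and residual: "norm (f x\<^sub>0) \<le> \<mu>"
  obtains u where "f u = 0"
    and "norm (u - x\<^sub>0) \<le> (\<beta> - sqrt (\<beta>\<^sup>2 - 2 * L * \<mu>)) / L"
    and "\<And>v. f v = 0 \<Longrightarrow> norm (v - x\<^sub>0) < (\<beta> + sqrt (\<beta>\<^sup>2 - 2 * L * \<mu>)) / L \<Longrightarrow> v = u"
    and "bij (blinfun_apply (f' u))"
    and "\<And>v. sqrt (\<beta>\<^sup>2 - 2 * L * \<mu>) * norm v \<le> norm (f' u v)"
proof -
  define A where "A = f' x\<^sub>0"
  define s where "s = sqrt (\<beta>\<^sup>2 - 2 * L * \<mu>)"
  define r where "r = (\<beta> - s) / L"
  have s: "s > 0" "s\<^sup>2 = \<beta>\<^sup>2 - 2 * L * \<mu>" using small by (simp_all add: s_def)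
  have "s\<^sup>2 \<le> \<beta>\<^sup>2" using s(2) pos by simp
  then have "s \<le> \<beta>" using pos(1) by (simp add: power2_le_iff_abs_le)
  then have r: "r \<ge> 0" and Lr: "L * r = \<beta> - s" using pos by (simp_all add: r_def)
  \<comment> \<open>After multiplication by \<open>L\<close>, everything is expressed through
    \<open>L * r = \<beta> - s\<close>, and the identity reduces to the formula for the square of
    \<open>s\<close>.\<close>
  have quad: "\<mu> + L / 2 * r * r = \<beta> * r"
  proof -
    have "L * (\<mu> + L / 2 * r * r) = L * \<mu> + (L * r) * (L * r) / 2" by (simp add: algebra_simps)
    also have "\<dots> = \<beta> * (L * r)"
      unfolding Lr using s(2) by (simp add: power2_eq_square field_simps)
    finally have "L * (\<mu> + L / 2 * r * r) = L * (\<beta> * r)" by (simp add: mult_ac)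
    then show ?thesis using pos by simp
  qed
  have error: "norm (f x - f y - A (x - y)) \<le> L / 2 * (norm (x - x\<^sub>0) + norm (y - x\<^sub>0)) * norm (x - y)" for x y
    unfolding A_def using linearization_error[of f f' L, OF deriv lip] pos by simp
  define T where "T x = x - inv (blinfun_apply A) (f x)" for x
  have AT: "A (T x) = A x - f x" for x
    using bij by (simp add: T_def A_def blinfun.diff_right bij_is_surj surj_f_inv_f)
  have "\<exists>!x\<in>cball x\<^sub>0 r. T x = x"
  proof (rule Banach_fix)
    show "complete (cball x\<^sub>0 r)" by (simp add: complete_eq_closed)
    show "cball x\<^sub>0 r \<noteq> {}" "0 \<le> L * r / \<beta>" using r pos by simp_all
    \<comment> \<open>The contraction factor equals 1 - s / \<beta>.\<close>
    show "L * r / \<beta> < 1" unfolding Lr using pos s by simp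
    show "T ` cball x\<^sub>0 r \<subseteq> cball x\<^sub>0 r"
    proof clarify
      fix x assume "x \<in> cball x\<^sub>0 r"
      then have x: "norm (x - x\<^sub>0) \<le> r" by (simp add: dist_norm norm_minus_commute)
      \<comment> \<open>\<open>A (T x - x\<^sub>0)\<close> is, up to sign, the residual at
        \<open>x\<^sub>0\<close> plus the linearization error with \<open>y = x\<^sub>0\<close>,
        where one of the two distances vanishes. The resulting bound is exactly the left side of
        \<open>quad\<close>.\<close>
      have "\<beta> * norm (T x - x\<^sub>0) \<le> norm (A (T x - x\<^sub>0))" unfolding A_def by (rule lower)
      also have "A (T x - x\<^sub>0) = - (f x\<^sub>0 + (f x - f x\<^sub>0 - A (x - x\<^sub>0)))"
        by (simp only: blinfun.diff_right AT) simp
      also have "norm \<dots> \<le> norm (f x\<^sub>0) + norm (f x - f x\<^sub>0 - A (x - x\<^sub>0))"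
        unfolding norm_minus_cancel by (rule norm_triangle_ineq)
      also have "\<dots> \<le> \<mu> + L / 2 * norm (x - x\<^sub>0) * norm (x - x\<^sub>0)"
        using residual error[of x x\<^sub>0] by simp
      also have "\<dots> \<le> \<mu> + L / 2 * r * r"
        using x r pos by (intro add_left_mono mult_mono) auto
      also have "\<dots> = \<beta> * r" by (rule quad)
      finally show "T x \<in> cball x\<^sub>0 r" using pos by (simp add: dist_norm norm_minus_commute)
    qed
    fix x y assume xy: "x \<in> cball x\<^sub>0 r" "y \<in> cball x\<^sub>0 r"
    have "\<beta> * norm (T x - T y) \<le> norm (A (T x - T y))" unfolding A_def by (rule lower)
    also have "A (T x - T y) = - (f x - f y - A (x - y))"
      by (simp only: blinfun.diff_right AT) simp
    also have "norm \<dots> \<le> L / 2 * (norm (x - x\<^sub>0) + norm (y - x\<^sub>0)) * norm (x - y)"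
      unfolding norm_minus_cancel by (rule error)
    also have "\<dots> \<le> L / 2 * (r + r) * norm (x - y)"
      using xy pos by (intro mult_right_mono mult_left_mono add_mono)
        (auto simp: dist_norm norm_minus_commute)
    finally show "dist (T x) (T y) \<le> L * r / \<beta> * dist x y"
      using pos by (simp add: dist_norm field_simps)
  qed
  then obtain u where u: "u \<in> cball x\<^sub>0 r" "T u = u" by blast
  have root: "f u = 0" using AT[of u] u by simp
  have near: "norm (u - x\<^sub>0) \<le> r" using u by (simp add: dist_norm norm_minus_commute)
  \<comment> \<open>The radius also controls the derivative: passing from \<open>A\<close> to
    \<open>f' u\<close> costs at most \<open>\<beta> - s\<close> of the lower bound \<beta>. What
    remains is \<open>s\<close>, and since \<open>s > 0\<close> bijectivity survives the
    perturbation.\<close>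
  have "norm (f' u - A) \<le> L * norm (u - x\<^sub>0)" unfolding A_def by (rule lip)
  also have "\<dots> \<le> L * r" using near pos by simp
  finally have close: "norm (f' u - A) \<le> \<beta> - s" unfolding Lr .
  show thesis
  proof (rule that[OF root near[unfolded r_def s_def]])
    fix v assume v: "f v = 0" "norm (v - x\<^sub>0) < (\<beta> + sqrt (\<beta>\<^sup>2 - 2 * L * \<mu>)) / L"
    show "v = u"
    proof (rule ccontr)
      assume "v \<noteq> u"
      have "\<beta> * norm (v - u) \<le> norm (A (v - u))" unfolding A_def by (rule lower)
      also have "\<dots> = norm (f v - f u - A (v - u))" using v root by simp
      also have "\<dots> \<le> L / 2 * (norm (v - x\<^sub>0) + norm (u - x\<^sub>0)) * norm (v - u)" by (rule error)
      also have "\<dots> < L / 2 * ((\<beta> + s) / L + r) * norm (v - u)"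
        using v near pos \<open>v \<noteq> u\<close> unfolding s_def
        by (intro mult_strict_right_mono mult_strict_left_mono add_less_le_mono) auto
      also have "\<dots> = \<beta> * norm (v - u)" using pos by (simp add: r_def field_simps)
      finally show False by simp
    qed
  next
    show "bij (blinfun_apply (f' u))"
      using bij_blinfun_perturb[OF bij lower, of "f' u"] close s by (simp add: A_def)
  next
    fix v
    have "\<beta> * norm v \<le> norm (A v)" unfolding A_def by (rule lower)
    also have "A v = f' u v - (f' u - A) v" by (simp add: blinfun.diff_left)
    also have "norm \<dots> \<le> norm (f' u v) + norm ((f' u - A) v)" by (rule norm_triangle_ineq4)
    also have "norm ((f' u - A) v) \<le> (\<beta> - s) * norm v"
      by (rule order_trans[OF norm_blinfun mult_right_mono[OF close]]) simp
    finally show "sqrt (\<beta>\<^sup>2 - 2 * L * \<mu>) * norm v \<le> norm (f' u v)"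
      by (simp add: s_def algebra_simps)
  qed
qed

section \<open>Geometry of the seminorm on V + V_nc and distances to the smoothed point\<close>

context nonconforming_setting
begin

lemma pw_norm_nonneg: "0 \<le> pw_norm a_pw x"
  using pw_nonneg by (simp add: pw_norm_def)

lemma pw_norm_sq: "(pw_norm a_pw x)\<^sup>2 = a_pw x x"
  using pw_nonneg by (simp add: pw_norm_def)

lemma pw_norm_iV: "pw_norm a_pw (iV v) = norm v"
  using pw_extends by (simp add: pw_norm_def norm_eq_sqrt_inner)

lemmas pw_simps = bilinear_ladd[OF pw_bilinear] bilinear_radd[OF pw_bilinear]
  bilinear_lmul[OF pw_bilinear] bilinear_rmul[OF pw_bilinear]
  bilinear_lsub[OF pw_bilinear] bilinear_rsub[OF pw_bilinear]

lemma pw_norm_scale: "pw_norm a_pw (c *\<^sub>R x) = \<bar>c\<bar> * pw_norm a_pw x"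
  by (simp add: pw_norm_def pw_simps real_sqrt_mult)

lemma pw_norm_minus_commute: "pw_norm a_pw (x - y) = pw_norm a_pw (y - x)"
  using pw_norm_scale[of "-1" "x - y"] by simp

text \<open>One identity with two uses: nonnegativity of the left side yields Cauchy-Schwarz, and
  vanishing of the right side yields collinearity in the equality case of the triangle
  inequality.\<close>

lemma pw_norm_sq_combination:
  "(pw_norm a_pw (pw_norm a_pw y *\<^sub>R x - pw_norm a_pw x *\<^sub>R y))\<^sup>2
    = 2 * pw_norm a_pw x * pw_norm a_pw y * (pw_norm a_pw x * pw_norm a_pw y - a_pw x y)"
proof -
  have yx: "a_pw y x = a_pw x y" using pw_sym by simp
  show ?thesis
    unfolding pw_norm_sq[of "_ - _"] pw_simps yx pw_norm_sq[of x, symmetric] pw_norm_sq[of y, symmetric]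
    by (simp add: algebra_simps power2_eq_square)
qed

text \<open>If \<open>y\<close> has seminorm 0, the quadratic form is affine along the line through
  \<open>x\<close> in direction \<open>y\<close>, and it stays nonnegative only if its slope is 0.
  This covers the degenerate case of Cauchy-Schwarz, where the factor in
  \<open>pw_norm_sq_combination\<close> cannot be cancelled.\<close>

lemma pw_null: "a_pw x y = 0" if "a_pw y y = 0"
proof (rule ccontr)
  assume xy: "a_pw x y \<noteq> 0"
  \<comment> \<open>Chosen so that the form takes the value -1 at
    \<open>x + c *\<^sub>R y\<close>.\<close>
  define c where "c = - (a_pw x x + 1) / (2 * a_pw x y)"
  have "0 \<le> a_pw (x + c *\<^sub>R y) (x + c *\<^sub>R y)" using pw_nonneg by simp
  also have "\<dots> = a_pw x x + 2 * c * a_pw x y"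
    using that pw_sym by (simp add: pw_simps)
  also have "\<dots> = - 1" using xy by (simp add: c_def field_simps)
  finally show False by simp
qed

lemma pw_Cauchy_Schwarz: "a_pw x y \<le> pw_norm a_pw x * pw_norm a_pw y"
proof (cases "a_pw x x = 0 \<or> a_pw y y = 0")
  case True
  then have "a_pw x y = 0" using pw_null pw_sym by metis
  then show ?thesis by (simp add: pw_norm_nonneg)
next
  case False
  then have "0 < pw_norm a_pw x * pw_norm a_pw y"
    using pw_nonneg by (simp add: pw_norm_def less_le)
  moreover have "0 \<le> 2 * pw_norm a_pw x * pw_norm a_pw y * (pw_norm a_pw x * pw_norm a_pw y - a_pw x y)"
    by (metis pw_norm_sq_combination zero_le_power2)
  then have "0 \<le> 2 * (pw_norm a_pw x * pw_norm a_pw y) * (pw_norm a_pw x * pw_norm a_pw y - a_pw x y)"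
    by (simp add: mult_ac)
  ultimately show ?thesis by (simp add: zero_le_mult_iff[of "2 * _"])
qed

lemma pw_norm_triangle: "pw_norm a_pw (x + y) \<le> pw_norm a_pw x + pw_norm a_pw y"
proof (rule power2_le_imp_le)
  have "a_pw y x = a_pw x y" using pw_sym by simp
  then show "(pw_norm a_pw (x + y))\<^sup>2 \<le> (pw_norm a_pw x + pw_norm a_pw y)\<^sup>2"
    using pw_Cauchy_Schwarz[of x y]
    by (simp add: power2_sum pw_norm_sq pw_simps)
qed (simp add: pw_norm_nonneg)

text \<open>Squaring the equality forces equality in Cauchy-Schwarz. As the form is only
  semidefinite, collinearity holds up to a vector of seminorm 0.\<close>

lemma pw_norm_collinear:
  assumes "pw_norm a_pw (x + y) = pw_norm a_pw x + pw_norm a_pw y"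
  shows "pw_norm a_pw (pw_norm a_pw y *\<^sub>R x - pw_norm a_pw x *\<^sub>R y) = 0"
proof -
  have "a_pw y x = a_pw x y" using pw_sym by simp
  moreover have "a_pw (x + y) (x + y) = (pw_norm a_pw x + pw_norm a_pw y)\<^sup>2"
    using assms pw_norm_sq[of "x + y"] by simp
  ultimately have "a_pw x y = pw_norm a_pw x * pw_norm a_pw y"
    by (simp add: power2_sum pw_norm_sq pw_simps)
  then show ?thesis
    using pw_norm_sq_combination[of y x] by simp
qed

text \<open>A point of V at distance 0 makes the infimum in \<open>quasi_optimal\<close> vanish.
  Read contrapositively, a \<open>w\<close> at positive distance from \<open>J w\<close> has
  positive distance from every point of V.\<close>

lemma smoother_exact:
  assumes "pw_norm a_pw (iV v - iN w) = 0"
  shows "pw_norm a_pw (iN w - iV (J w)) = 0"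
proof -
  obtain \<Lambda> where \<Lambda>: "\<Lambda> > 0"
    "pw_norm a_pw (iN w - iV (J w)) \<le> \<Lambda> * (INF v. pw_norm a_pw (iV v - iN w))"
    using quasi_optimal by blast
  have "(INF v. pw_norm a_pw (iV v - iN w)) \<le> pw_norm a_pw (iV v - iN w)"
    by (rule cINF_lower) (auto intro!: bdd_belowI[of _ 0] pw_norm_nonneg)
  then have "\<Lambda> * (INF v. pw_norm a_pw (iV v - iN w)) \<le> 0"
    using \<Lambda>(1) assms by (simp add: mult_le_0_iff)
  then show ?thesis using \<Lambda>(2) pw_norm_nonneg by (meson order_antisym order_trans)
qed

text \<open>Moves a root near \<open>w\<close> into a ball around \<open>J w\<close>, where
  uniqueness is known; \<open>dist_pw_le\<close> goes the opposite way, for the existence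
  bound.\<close>

lemma dist_smoother_le:
  "norm (v - J w) \<le> pw_norm a_pw (iV v - iN w) + pw_norm a_pw (iN w - iV (J w))"
  using pw_norm_triangle[of "iV v - iN w" "iN w - iV (J w)"]
  by (simp add: pw_norm_iV flip: linear_diff[OF linear_iV])

lemma dist_smoother_less:
  assumes "pw_norm a_pw (iN w - iV (J w)) \<noteq> 0"
  shows "norm (v - J w) < pw_norm a_pw (iV v - iN w) + pw_norm a_pw (iN w - iV (J w))"
proof (rule ccontr)
  define p where "p = pw_norm a_pw (iV v - iN w)"
  define d where "d = pw_norm a_pw (iN w - iV (J w))"
  have "p \<ge> 0" "d > 0" using assms pw_norm_nonneg by (simp_all add: p_def d_def less_le)
  assume "\<not> ?thesis"
  then have "norm (v - J w) = p + d"
    using dist_smoother_le[of v w] by (simp add: p_def d_def)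
  then have "pw_norm a_pw ((iV v - iN w) + (iN w - iV (J w))) = p + d"
    by (simp add: pw_norm_iV flip: linear_diff[OF linear_iV])
  then have collinear: "pw_norm a_pw (d *\<^sub>R (iV v - iN w) - p *\<^sub>R (iN w - iV (J w))) = 0"
    using pw_norm_collinear unfolding p_def d_def by blast
  \<comment> \<open>The convex combination of \<open>v\<close> and \<open>J w\<close> with weights d
    / (p + d) and p / (p + d), for which \<open>p + d\<close> times \<open>iV z - iN w\<close> is
    precisely the null combination in \<open>collinear\<close>.\<close>
  define z where "z = (1 / (p + d)) *\<^sub>R (d *\<^sub>R v + p *\<^sub>R J w)"
  have "(p + d) *\<^sub>R (iV z - iN w) = d *\<^sub>R (iV v - iN w) - p *\<^sub>R (iN w - iV (J w))"
    using \<open>p \<ge> 0\<close> \<open>d > 0\<close>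
    by (simp add: z_def linear_add[OF linear_iV] linear_scale[OF linear_iV] scaleR_diff_right)
      (simp add: algebra_simps)
  then have "pw_norm a_pw ((p + d) *\<^sub>R (iV z - iN w)) = 0" using collinear by simp
  then have "pw_norm a_pw (iV z - iN w) = 0"
    using \<open>p \<ge> 0\<close> \<open>d > 0\<close> by (simp add: pw_norm_scale)
  then show False using smoother_exact assms by blast
qed

lemma dist_pw_le:
  "pw_norm a_pw (iV v - iN w) \<le> norm (v - J w) + pw_norm a_pw (iN w - iV (J w))"
  using pw_norm_triangle[of "iV v - iV (J w)" "iV (J w) - iN w"] pw_norm_iV[of "v - J w"]
  by (simp add: pw_norm_minus_commute[of "iV (J w)"] linear_diff[OF linear_iV])

end

section \<open>Existence, uniqueness and regularity of the root near \<open>v_nc\<close>\<close>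

theorem theorem2p7:
  fixes a_pw :: "'p::real_vector \<Rightarrow> 'p \<Rightarrow> real"
    and iV :: "'v::{real_inner,complete_space} \<Rightarrow> 'p"
    and iN :: "'n::real_inner \<Rightarrow> 'p"
    and I :: "'v \<Rightarrow>\<^sub>L 'n"
    and J :: "'n \<Rightarrow>\<^sub>L 'v"
    and G :: "'v \<Rightarrow> 'v \<Rightarrow>\<^sub>L real"
    and F :: "'v \<Rightarrow>\<^sub>L real"
    and v_nc :: 'n
    and \<beta> L \<mu> :: real
  assumes setting: "nonconforming_setting a_pw iV iN I J"
    and G_C1: "C1 G"
    and G_compact: "compact_operator G"
    and pos: "\<beta> > 0" "L > 0" "\<mu> > 0"
    and small: "2 * L * \<mu> < \<beta>\<^sup>2"
    and N1: "\<forall>v w. norm (frechet G v - frechet G w) \<le> L * norm (v - w)"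
    and N2: "norm (nonlin_op G F (blinfun_apply J v_nc)) \<le> \<mu>"
    and N3: "bij (blinfun_apply (frechet (nonlin_op G F) (blinfun_apply J v_nc)))"
      "ereal \<beta> \<le> inf_sup (frechet (nonlin_op G F) (blinfun_apply J v_nc))"
  shows "\<exists>u.
    nonlin_op G F u = 0 \<and>
    pw_norm a_pw (iV u - iN v_nc)
      \<le> (\<beta> - sqrt (\<beta>\<^sup>2 - 2 * L * \<mu>)) / L + pw_norm a_pw (iN v_nc - iV (blinfun_apply J v_nc)) \<and>
    \<not> (\<exists>v. v \<noteq> u \<and> nonlin_op G F v = 0 \<and>
      pw_norm a_pw (iV v - iN v_nc)
        < (\<beta> + sqrt (\<beta>\<^sup>2 - 2 * L * \<mu>)) / L - pw_norm a_pw (iN v_nc - iV (blinfun_apply J v_nc))) \<and>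
    (pw_norm a_pw (iN v_nc - iV (blinfun_apply J v_nc)) \<noteq> 0 \<longrightarrow>
      \<not> (\<exists>v. v \<noteq> u \<and> nonlin_op G F v = 0 \<and>
        pw_norm a_pw (iV v - iN v_nc)
          \<le> (\<beta> + sqrt (\<beta>\<^sup>2 - 2 * L * \<mu>)) / L - pw_norm a_pw (iN v_nc - iV (blinfun_apply J v_nc)))) \<and>
    regular_root (nonlin_op G F) u \<and>
    ereal (sqrt (\<beta>\<^sup>2 - 2 * L * \<mu>)) \<le> inf_sup (frechet (nonlin_op G F) u)"
proof -
  interpret nonconforming_setting a_pw iV iN I J by (rule setting)
  note D = nonlin_op_has_derivative[OF G_C1, of F]
  \<comment> \<open>The bilinear part of the derivative is the same at every point and cancels in
    the difference.\<close>
  have lip: "norm (frechet (nonlin_op G F) v - frechet (nonlin_op G F) w) \<le> L * norm (v - w)" for v w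
    using N1 by (simp add: D(2))
  have lower: "\<beta> * norm v \<le> norm (frechet (nonlin_op G F) (J v_nc) v)" for v
    using N3(2) unfolding inf_sup_ge_iff by blast
  obtain u where u: "nonlin_op G F u = 0"
      "norm (u - J v_nc) \<le> (\<beta> - sqrt (\<beta>\<^sup>2 - 2 * L * \<mu>)) / L"
      "bij (blinfun_apply (frechet (nonlin_op G F) u))"
      "\<And>v. sqrt (\<beta>\<^sup>2 - 2 * L * \<mu>) * norm v \<le> norm (frechet (nonlin_op G F) u v)"
    and unique: "\<And>v. nonlin_op G F v = 0 \<Longrightarrow>
      norm (v - J v_nc) < (\<beta> + sqrt (\<beta>\<^sup>2 - 2 * L * \<mu>)) / L \<Longrightarrow> v = u"
    by (rule newton_kantorovich[of "nonlin_op G F" "frechet (nonlin_op G F)",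
          OF D(1) lip pos(1,2) less_imp_le[OF pos(3)] small N3(1) lower N2]) blast
  show ?thesis
  proof (intro exI[of _ u] conjI impI notI)
    show "nonlin_op G F u = 0" by (rule u(1))
    show "pw_norm a_pw (iV u - iN v_nc)
      \<le> (\<beta> - sqrt (\<beta>\<^sup>2 - 2 * L * \<mu>)) / L + pw_norm a_pw (iN v_nc - iV (J v_nc))"
      using dist_pw_le[of u v_nc] u(2) by linarith
    show "regular_root (nonlin_op G F) u" using u by (simp add: regular_root_def)
    show "ereal (sqrt (\<beta>\<^sup>2 - 2 * L * \<mu>)) \<le> inf_sup (frechet (nonlin_op G F) u)"
      using u(4) by (simp add: inf_sup_ge_iff)
  next
    assume "\<exists>v. v \<noteq> u \<and> nonlin_op G F v = 0 \<and>
      pw_norm a_pw (iV v - iN v_nc)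
        < (\<beta> + sqrt (\<beta>\<^sup>2 - 2 * L * \<mu>)) / L - pw_norm a_pw (iN v_nc - iV (J v_nc))"
    then obtain v where v: "v \<noteq> u" "nonlin_op G F v = 0" "pw_norm a_pw (iV v - iN v_nc)
        < (\<beta> + sqrt (\<beta>\<^sup>2 - 2 * L * \<mu>)) / L - pw_norm a_pw (iN v_nc - iV (J v_nc))"
      by blast
    \<comment> \<open>Strictness comes from the open ball, so the plain triangle inequality
      suffices.\<close>
    from v(3) have "norm (v - J v_nc) < (\<beta> + sqrt (\<beta>\<^sup>2 - 2 * L * \<mu>)) / L"
      using dist_smoother_le[of v v_nc] by linarith
    then show False using unique v by blast
  next
    assume d: "pw_norm a_pw (iN v_nc - iV (J v_nc)) \<noteq> 0"
    assume "\<exists>v. v \<noteq> u \<and> nonlin_op G F v = 0 \<and>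
        pw_norm a_pw (iV v - iN v_nc)
          \<le> (\<beta> + sqrt (\<beta>\<^sup>2 - 2 * L * \<mu>)) / L - pw_norm a_pw (iN v_nc - iV (J v_nc))"
    then obtain v where v: "v \<noteq> u" "nonlin_op G F v = 0" "pw_norm a_pw (iV v - iN v_nc)
          \<le> (\<beta> + sqrt (\<beta>\<^sup>2 - 2 * L * \<mu>)) / L - pw_norm a_pw (iN v_nc - iV (J v_nc))"
      by blast
    \<comment> \<open>On the closed ball the strictness has to come from the triangle inequality
      itself, which is where \<open>d\<close> enters.\<close>
    from v(3) have "norm (v - J v_nc) < (\<beta> + sqrt (\<beta>\<^sup>2 - 2 * L * \<mu>)) / L"
      using dist_smoother_less[OF d, of v] by linarith
    then show False using unique v by blast
  qed
qed

end
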